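(* Let $G_1$ be a connected graph and $G_2$ a connected $k$-regular graph with $m_2$ vertices. Let $v\in V(G_1)$ and suppose there is an eigenvalue $\lambda\in\operatorname{supp}_{G_1}(v)$ with $\lambda\in\mathbb{Z}\sqrt{\Delta'}$ for some square-free integer $\Delta'>1$. Then $(v,w)$ is not periodic in $G_1\bigstar G_2$ for any $w\in V(G_2)\cup\{0\}$.
   Context: All graphs are finite, simple and undirected. For graphs $G_1$ (order $n_1$) and $G_2$, the neighborhood corona $G_1\bigstar G_2$ is obtained from one copy of $G_1$ and $n_1$ copies of $G_2$ by joining every neighbor (in $G_1$) of the $i$-th vertex of $G_1$ to every vertex of the $i$-th copy of $G_2$. Its vertex set is $V(G_1)\times(\{0\}\cup V(G_2))$, where $(x,0)$ is vertex $x$ of $G_1$ and $(x,y)$ is vertex $y$ of the copy attached to $x$. For a graph $G$ and eigenvalue $\lambda$ of its adjacency matrix $A(G)$, $f_\lambda(G)$ is the orthogonal projection onto the $\lambda$-eigenspace; $\operatorname{supp}_G(x)=\{\lambda: f_\lambda(G)e_x\neq0\}$. A vertex $u$ is periodic if $|e_u^T\exp(-itA(G))e_u|=1$ for some $t>0$. $\mathbb{Z}\sqrt{\Delta'}=\{b\sqrt{\Delta'}:b\in\mathbb{Z}\}$.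
   Formalization: The eigenvalue λ is additionally assumed to be nonzero; since ℤ√Δ' contains 0, the claim as stated fails, e.g. for G₁ = K₁, where supp(v) = {0} and (v,0) is an isolated, hence periodic, vertex. *)

theory Defs
  imports "HOL-Analysis.Analysis" "HOL-Computational_Algebra.Squarefree"
begin

text \<open>
  A graph is given by its adjacency relation on a finite vertex type, the type itself being
  the vertex set. In particular every graph has at least one vertex.
\<close>

definition simple_graph :: "('a::finite \<Rightarrow> 'a \<Rightarrow> bool) \<Rightarrow> bool" where
  "simple_graph E \<longleftrightarrow> symp E \<and> irreflp E"

definition connected_graph :: "('a::finite \<Rightarrow> 'a \<Rightarrow> bool) \<Rightarrow> bool" where
  "connected_graph E \<longleftrightarrow> (\<forall>x y. E\<^sup>*\<^sup>* x y)"

definition regular_graph :: "nat \<Rightarrow> ('a::finite \<Rightarrow> 'a \<Rightarrow> bool) \<Rightarrow> bool" where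
  "regular_graph k E \<longleftrightarrow> (\<forall>x. card {y. E x y} = k)"

text \<open>
  The vertex set \<open>V(G\<^sub>1) \<times> ({0} \<union> V(G\<^sub>2))\<close> of the neighborhood corona is the type
  \<open>'a \<times> 'b option\<close>: \<open>(x, None)\<close> is the vertex \<open>x\<close> of \<open>G\<^sub>1\<close>, and \<open>(x, Some y)\<close> is the
  vertex \<open>y\<close> of the copy of \<open>G\<^sub>2\<close> attached to \<open>x\<close>.
\<close>

fun nbhd_corona ::
  "('a::finite \<Rightarrow> 'a \<Rightarrow> bool) \<Rightarrow> ('b::finite \<Rightarrow> 'b \<Rightarrow> bool) \<Rightarrow>
   'a \<times> 'b option \<Rightarrow> 'a \<times> 'b option \<Rightarrow> bool" where
  "nbhd_corona E\<^sub>1 E\<^sub>2 (x, None) (x', None) \<longleftrightarrow> E\<^sub>1 x x'"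
| "nbhd_corona E\<^sub>1 E\<^sub>2 (x, None) (x', Some y') \<longleftrightarrow> E\<^sub>1 x' x"
| "nbhd_corona E\<^sub>1 E\<^sub>2 (x, Some y) (x', None) \<longleftrightarrow> E\<^sub>1 x x'"
| "nbhd_corona E\<^sub>1 E\<^sub>2 (x, Some y) (x', Some y') \<longleftrightarrow> x = x' \<and> E\<^sub>2 y y'"

lemma simple_graph_nbhd_corona:
  assumes "simple_graph E\<^sub>1" "simple_graph E\<^sub>2"
  shows "simple_graph (nbhd_corona E\<^sub>1 E\<^sub>2)"
  unfolding simple_graph_def
proof
  show "symp (nbhd_corona E\<^sub>1 E\<^sub>2)"
  proof (rule sympI)
    fix p q assume "nbhd_corona E\<^sub>1 E\<^sub>2 p q"
    then show "nbhd_corona E\<^sub>1 E\<^sub>2 q p"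
      using assms
      by (cases "(E\<^sub>1, E\<^sub>2, p, q)" rule: nbhd_corona.cases)
         (auto simp: simple_graph_def dest: sympD)
  qed
  show "irreflp (nbhd_corona E\<^sub>1 E\<^sub>2)"
  proof (rule irreflpI)
    fix p show "\<not> nbhd_corona E\<^sub>1 E\<^sub>2 p p"
      using assms
      by (cases "(E\<^sub>1, E\<^sub>2, p, p)" rule: nbhd_corona.cases)
         (auto simp: simple_graph_def irreflp_def)
  qed
qed

definition adj_matrix :: "('a::finite \<Rightarrow> 'a \<Rightarrow> bool) \<Rightarrow> 'f::zero_neq_one ^ 'a ^ 'a" where
  "adj_matrix E = (\<chi> i j. if E i j then 1 else 0)"

definition eigenspace :: "('a::finite \<Rightarrow> 'a \<Rightarrow> bool) \<Rightarrow> real \<Rightarrow> (real ^ 'a) set" where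
  "eigenspace E \<theta> = {x. adj_matrix E *v x = \<theta> *\<^sub>R x}"

definition graph_eigenvalue :: "('a::finite \<Rightarrow> 'a \<Rightarrow> bool) \<Rightarrow> real \<Rightarrow> bool" where
  "graph_eigenvalue E \<theta> \<longleftrightarrow> (\<exists>x :: real ^ 'a. x \<noteq> 0 \<and> adj_matrix E *v x = \<theta> *\<^sub>R x)"

definition orth_proj :: "'v::euclidean_space set \<Rightarrow> 'v \<Rightarrow> 'v" where
  "orth_proj S x = (THE y. y \<in> S \<and> (\<forall>z\<in>S. orthogonal (x - y) z))"

text \<open>The map \<open>f\<^sub>\<theta>(G)\<close>.\<close>

definition spectral_proj ::
  "('a::finite \<Rightarrow> 'a \<Rightarrow> bool) \<Rightarrow> real \<Rightarrow> real ^ 'a \<Rightarrow> real ^ 'a" where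
  "spectral_proj E \<theta> = orth_proj (eigenspace E \<theta>)"

definition eigenvalue_support :: "('a::finite \<Rightarrow> 'a \<Rightarrow> bool) \<Rightarrow> 'a \<Rightarrow> real set" where
  "eigenvalue_support E x = {\<theta>. graph_eigenvalue E \<theta> \<and> spectral_proj E \<theta> (axis x 1) \<noteq> 0}"

text \<open>
  The operators \<open>*\<close>, \<open>^\<close> and \<open>exp\<close> on the vector types are not the matrix ones
  (\<open>*\<close> and \<open>^\<close> act entrywise), hence the iteration of \<open>**\<close> in the exponential series.
\<close>

definition matrix_exp :: "complex ^ 'n ^ 'n \<Rightarrow> complex ^ 'n ^ 'n" where
  "matrix_exp A = (\<Sum>n. (1 / fact n) *\<^sub>R (((**) A) ^^ n) (mat 1))"

definition transition_matrix ::
  "('a::finite \<Rightarrow> 'a \<Rightarrow> bool) \<Rightarrow> real \<Rightarrow> complex ^ 'a ^ 'a" where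
  "transition_matrix E t =
     matrix_exp (map_matrix (\<lambda>a. - \<i> * complex_of_real t * a) (adj_matrix E))"

text \<open>The \<open>(u, u)\<close> entry below is \<open>e\<^sub>u\<^sup>T exp(-itA) e\<^sub>u\<close>.\<close>

definition periodic_vertex :: "('a::finite \<Rightarrow> 'a \<Rightarrow> bool) \<Rightarrow> 'a \<Rightarrow> bool" where
  "periodic_vertex E u \<longleftrightarrow> (\<exists>t>0. cmod (transition_matrix E t $ u $ u) = 1)"

text \<open>
  This set contains \<open>0\<close>. A zero eigenvalue in the support does not prevent periodicity, e.g. for
  the one-vertex graph \<open>G\<^sub>1\<close>, so \<open>0\<close> has to be excluded separately wherever irrationality is meant.
\<close>

definition int_multiples_sqrt :: "int \<Rightarrow> real set" where
  "int_multiples_sqrt D = {of_int b * sqrt (of_int D) | b :: int. True}"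

end

theory Submission
  imports Defs
begin

text \<open>
  At a periodic vertex all phases \<open>exp (- \<i> t \<mu>)\<close> with \<open>\<mu>\<close> in its support coincide, so ratios of
  differences of such eigenvalues are rational. Since \<open>\<theta>\<close> is a quadratic irrational, its
  conjugate \<open>-\<theta>\<close> also lies in the support of \<open>v\<close>. Each \<open>\<eta> \<in> {\<theta>, -\<theta>}\<close> lifts to the two roots
  \<open>(k + \<eta> \<plusminus> S(\<eta>)) / 2\<close> of \<open>(\<mu> - \<eta>) (\<mu> - k) = m\<^sub>2 \<eta>\<^sup>2\<close> in the support of \<open>(v, w)\<close>, so
  \<open>S(\<theta>) / S(-\<theta>)\<close> is rational. As \<open>S(\<plusminus>\<theta>)\<^sup>2 = k\<^sup>2 + (1 + 4 m\<^sub>2) \<theta>\<^sup>2 \<mp> 2 k \<theta>\<close>, this forces \<open>k = 0\<close>;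
  then \<open>m\<^sub>2 = 1\<close> by connectedness, and the differences \<open>S(\<theta>) = \<surd>5 \<bar>\<theta>\<bar>\<close> and \<open>\<theta>\<close> have an
  irrational ratio.
\<close>

section \<open>Matrix powers and the matrix exponential, entry by entry\<close>

abbreviation mpow :: "complex ^ 'n ^ 'n \<Rightarrow> nat \<Rightarrow> complex ^ 'n ^ 'n" where
  "mpow A n \<equiv> (((**) A) ^^ n) (mat 1)"

text \<open>Each further factor \<open>A\<close> turns an entry into a sum of
  \<open>CARD('n)\<close> products, so the bound grows geometrically and the exponential series of a
  real number dominates.\<close>

lemma mpow_entry_bound:
  fixes A :: "complex ^ 'n ^ 'n"
  assumes "\<And>i j. cmod (A $ i $ j) \<le> C"
  shows "cmod (mpow A n $ i $ j) \<le> (real CARD('n) * C) ^ n"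
proof (induction n arbitrary: i j)
  case 0
  then show ?case by (simp add: mat_def)
next
  case (Suc n)
  have "cmod (mpow A (Suc n) $ i $ j) \<le> (\<Sum>l\<in>UNIV. cmod (A $ i $ l) * cmod (mpow A n $ l $ j))"
    by (simp add: matrix_matrix_mult_def sum_norm_le norm_mult)
  also have "\<dots> \<le> (\<Sum>l\<in>(UNIV :: 'n set). C * (real CARD('n) * C) ^ n)"
    by (intro sum_mono mult_mono assms Suc.IH norm_ge_zero order_trans[OF norm_ge_zero assms])
  finally show ?case by (simp add: mult.assoc)
qed

text \<open>Convergence is stated absolutely because Cauchy products of these series are formed
  later.\<close>

lemma summable_matrix_exp_entry:
  fixes A :: "complex ^ 'n ^ 'n"
  shows "summable (\<lambda>n. cmod (((1 / fact n) *\<^sub>R mpow A n) $ i $ j))"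
proof -
  define C where "C = (\<Sum>i\<in>UNIV. \<Sum>j\<in>UNIV. cmod (A $ i $ j))"
  have C: "cmod (A $ i $ j) \<le> C" for i j
  proof -
    have "cmod (A $ i $ j) \<le> (\<Sum>j\<in>UNIV. cmod (A $ i $ j))"
      by (rule member_le_sum) auto
    also have "\<dots> \<le> C"
      unfolding C_def by (rule member_le_sum) (auto intro: sum_nonneg)
    finally show ?thesis .
  qed
  show ?thesis
  proof (rule summable_comparison_test')
    show "summable (\<lambda>n. inverse (fact n) * (real CARD('n) * C) ^ n)"
      by (rule summable_exp)
    show "norm (cmod (((1 / fact n) *\<^sub>R mpow A n) $ i $ j)) \<le> inverse (fact n) * (real CARD('n) * C) ^ n"
      for n
      using mpow_entry_bound[OF C, of n i j] by (simp add: divide_inverse)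
  qed
qed

text \<open>The series in \<open>matrix_exp\<close> is a limit of matrices. That limit is
  componentwise, so convergence of the entries both makes the series converge and allows it to be
  read off entrywise.\<close>

lemma matrix_exp_entry_sums:
  "(\<lambda>n. ((1 / fact n) *\<^sub>R mpow A n) $ i $ j) sums (matrix_exp A $ i $ j)"
proof -
  let ?f = "\<lambda>n. (1 / fact n) *\<^sub>R mpow A n"
  have "?f sums (\<chi> i j. \<Sum>n. ?f n $ i $ j)"
    unfolding sums_def
  proof (intro vec_tendstoI)
    fix i j
    have "(\<lambda>n. ?f n $ i $ j) sums (\<Sum>n. ?f n $ i $ j)"
      using summable_norm_cancel[OF summable_matrix_exp_entry] by (rule summable_sums)
    then show "(\<lambda>n. sum ?f {..<n} $ i $ j) \<longlonglongrightarrow> (\<chi> i j. \<Sum>n. ?f n $ i $ j) $ i $ j"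
      by (simp add: sums_def)
  qed
  then have "?f sums matrix_exp A"
    unfolding matrix_exp_def by (rule summable_sums[OF sums_summable])
  then show ?thesis by (intro sums_vec_nth)
qed

lemma mpow_add: "mpow A k ** mpow A l = mpow A (k + l)"
  by (induction k) (simp_all add: matrix_mul_assoc[symmetric])

lemma mpow_scale: "mpow (c *\<^sub>R A) n = c ^ n *\<^sub>R mpow A n"
  by (induction n) (simp_all add: scalar_matrix_assoc[symmetric] matrix_scalar_ac)

text \<open>In the Cauchy product of the two series the coefficient of \<open>mpow A n\<close> is
  the binomial expansion of \<open>(1 - 1) ^ n / fact n\<close>, so only \<open>n = 0\<close>
  survives.\<close>

lemma matrix_exp_minus_right: "matrix_exp A ** matrix_exp (- A) = mat 1"
proof -
  have "(matrix_exp A ** matrix_exp (- A)) $ i $ j = mat 1 $ i $ j" for i j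
  proof -
    let ?a = "\<lambda>A i j n. ((1 / fact n) *\<^sub>R mpow A n) $ i $ j"
    have "(\<lambda>n. \<Sum>k\<le>n. ?a A i l k * ?a (- A) l j (n - k)) sums
        (matrix_exp A $ i $ l * matrix_exp (- A) $ l $ j)" for l
      using Cauchy_product_sums[OF summable_matrix_exp_entry[of A i l] summable_matrix_exp_entry[of "- A" l j]]
      unfolding sums_unique[OF matrix_exp_entry_sums, symmetric] .
    then have "(\<lambda>n. \<Sum>l\<in>UNIV. \<Sum>k\<le>n. ?a A i l k * ?a (- A) l j (n - k)) sums
        (\<Sum>l\<in>UNIV. matrix_exp A $ i $ l * matrix_exp (- A) $ l $ j)"
      by (rule sums_sum)
    moreover have "(\<Sum>l\<in>UNIV. \<Sum>k\<le>n. ?a A i l k * ?a (- A) l j (n - k)) =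
        (if n = 0 then mat 1 $ i $ j else 0)" for n
    proof -
      have "(\<Sum>l\<in>UNIV. ?a A i l k * ?a (- A) l j (n - k)) =
          (1 / fact k * ((-1) ^ (n - k) / fact (n - k))) *\<^sub>R mpow A n $ i $ j" if "k \<le> n" for k
      proof -
        have "mpow (- A) (n - k) = (-1) ^ (n - k) *\<^sub>R mpow A (n - k)"
          using mpow_scale[of "n - k" "-1" A] by simp
        then have "(\<Sum>l\<in>UNIV. ?a A i l k * ?a (- A) l j (n - k)) =
            (1 / fact k * ((-1) ^ (n - k) / fact (n - k))) *\<^sub>R (mpow A k ** mpow A (n - k)) $ i $ j"
          by (simp add: matrix_matrix_mult_def scaleR_sum_right mult.commute)
        then show ?thesis
          using that by (simp add: mpow_add)
      qed
      then have "(\<Sum>k\<le>n. \<Sum>l\<in>UNIV. ?a A i l k * ?a (- A) l j (n - k)) =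
          (\<Sum>k\<le>n. 1 / fact k * ((-1) ^ (n - k) / fact (n - k))) *\<^sub>R mpow A n $ i $ j"
        by (simp add: scaleR_sum_left)
      \<comment> \<open>The coefficient is that of the scalar series for
        \<open>exp (1 + (-1))\<close>.\<close>
      also have "(\<Sum>k\<le>n. 1 / fact k * ((-1) ^ (n - k) / fact (n - k))) = (0 ^ n / fact n :: real)"
        using exp_series_add_commuting[of "1::real" "-1" n] by (simp add: divide_inverse mult_ac)
      finally show ?thesis
        by (subst sum.swap) (simp add: power_0_left)
    qed
    ultimately have "(\<lambda>n. if n = 0 then mat 1 $ i $ j else 0) sums
        (\<Sum>l\<in>UNIV. matrix_exp A $ i $ l * matrix_exp (- A) $ l $ j)"
      by simp
    moreover have "(\<lambda>n. if n = 0 then mat 1 $ i $ j else (0::complex)) sums (mat 1 $ i $ j)"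
      using sums_single[of 0 "\<lambda>_. mat 1 $ i $ j"] by simp
    ultimately show ?thesis
      by (simp add: matrix_matrix_mult_def sums_unique2)
  qed
  then show ?thesis by (simp add: vec_eq_iff)
qed

lemma mpow_commute: "mpow A n ** A = A ** mpow A n"
  using mpow_add[of n A 1] by simp

text \<open>Transposition reverses products; the order is restored because \<open>A\<close> commutes
  with its powers.\<close>

lemma mpow_adjoint:
  "mpow (map_matrix cnj (transpose A)) n = map_matrix cnj (transpose (mpow A n))"
proof (induction n)
  case 0
  then show ?case by (auto simp: mat_def transpose_def vec_eq_iff)
next
  case (Suc n)
  have "mpow (map_matrix cnj (transpose A)) (Suc n) = map_matrix cnj (transpose (mpow A n ** A))"
    unfolding funpow.simps comp_apply Suc.IH
    by (simp add: vec_eq_iff matrix_matrix_mult_def transpose_def mult.commute)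
  then show ?case by (simp add: mpow_commute)
qed

lemma matrix_exp_adjoint:
  "matrix_exp (map_matrix cnj (transpose A)) = map_matrix cnj (transpose (matrix_exp A))"
proof -
  have "matrix_exp (map_matrix cnj (transpose A)) $ i $ j = cnj (matrix_exp A $ j $ i)" for i j
  proof (rule sums_unique2[OF matrix_exp_entry_sums])
    show "(\<lambda>n. ((1 / fact n) *\<^sub>R mpow (map_matrix cnj (transpose A)) n) $ i $ j) sums
        cnj (matrix_exp A $ j $ i)"
      using iffD2[OF sums_cnj matrix_exp_entry_sums[of A j i]]
      unfolding mpow_adjoint by (simp add: transpose_def)
  qed
  then show ?thesis by (simp add: vec_eq_iff transpose_def)
qed

lemma matrix_exp_eigenvector:
  assumes "A *v z = \<mu> *s z"
  shows "matrix_exp A *v z = exp \<mu> *s z"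
proof -
  have pow: "mpow A n *v z = \<mu> ^ n *s z" for n
    by (induction n)
       (simp_all add: matrix_vector_mul_assoc[symmetric] assms vector_scalar_commute
          vector_smult_assoc mult.commute del: matrix_vector_mul_assoc)
  have "(matrix_exp A *v z) $ i = exp \<mu> * z $ i" for i
  proof -
    have "(\<lambda>n. \<Sum>j\<in>UNIV. ((1 / fact n) *\<^sub>R mpow A n) $ i $ j * z $ j) sums
        (\<Sum>j\<in>UNIV. matrix_exp A $ i $ j * z $ j)"
      by (intro sums_sum sums_mult2 matrix_exp_entry_sums)
    moreover have "(\<Sum>j\<in>UNIV. ((1 / fact n) *\<^sub>R mpow A n) $ i $ j * z $ j) = (\<mu> ^ n /\<^sub>R fact n) * z $ i"
      for n
    proof -
      have "(\<Sum>j\<in>UNIV. ((1 / fact n) *\<^sub>R mpow A n) $ i $ j * z $ j) = (1 / fact n) *\<^sub>R (mpow A n *v z) $ i"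
        by (simp add: matrix_vector_mult_def scaleR_sum_right)
      then show ?thesis by (simp add: pow divide_inverse)
    qed
    moreover have "(\<lambda>n. (\<mu> ^ n /\<^sub>R fact n) * z $ i) sums (exp \<mu> * z $ i)"
      by (intro sums_mult2 exp_converges)
    ultimately show ?thesis
      by (simp add: matrix_vector_mult_def sums_unique2)
  qed
  then show ?thesis by (simp add: vec_eq_iff)
qed

section \<open>Unitarity and the phases at a periodic vertex\<close>

text \<open>A real symmetric adjacency matrix makes the exponent \<open>B\<close> skew-Hermitian, so
  the adjoint of \<open>matrix_exp B\<close> is its inverse; the claim is the \<open>(u, u)\<close>
  entry of their product.\<close>

lemma transition_matrix_row_norm:
  assumes "simple_graph E"
  shows "(\<Sum>j\<in>UNIV. (cmod (transition_matrix E t $ u $ j))\<^sup>2) = 1"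
proof -
  define B :: "complex ^ 'a ^ 'a" where
    "B = map_matrix (\<lambda>a. - \<i> * complex_of_real t * a) (adj_matrix E)"
  have "E i j = E j i" for i j
    using assms by (auto simp: simple_graph_def dest: sympD)
  then have "map_matrix cnj (transpose B) = - B"
    by (auto simp: B_def vec_eq_iff transpose_def adj_matrix_def)
  then have "matrix_exp B ** map_matrix cnj (transpose (matrix_exp B)) = mat 1"
    using matrix_exp_minus_right[of B] matrix_exp_adjoint[of B] by simp
  then have "(matrix_exp B ** map_matrix cnj (transpose (matrix_exp B))) $ u $ u = 1"
    by (simp add: mat_def)
  then have "(\<Sum>j\<in>UNIV. matrix_exp B $ u $ j * cnj (matrix_exp B $ u $ j)) = 1"
    by (simp add: matrix_matrix_mult_def transpose_def)
  then have "complex_of_real (\<Sum>j\<in>UNIV. (cmod (matrix_exp B $ u $ j))\<^sup>2) = of_real 1"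
    by (simp only: of_real_sum of_real_1 complex_norm_square)
  then show ?thesis
    unfolding transition_matrix_def B_def[symmetric] of_real_eq_iff .
qed

lemma transition_matrix_eigenvector:
  assumes "adj_matrix E *v (x :: real ^ 'a) = \<mu> *\<^sub>R x"
  shows "transition_matrix E t *v (\<chi> i. complex_of_real (x $ i)) =
    exp (- \<i> * complex_of_real (t * \<mu>)) *s (\<chi> i. complex_of_real (x $ i))"
  unfolding transition_matrix_def
proof (rule matrix_exp_eigenvector)
  have "(\<Sum>j\<in>UNIV. (if E i j then 1 else 0) * x $ j) = \<mu> * x $ i" for i
    using assms by (simp add: vec_eq_iff matrix_vector_mult_def adj_matrix_def)
  then have "complex_of_real (\<Sum>j\<in>UNIV. (if E i j then 1 else 0) * x $ j) = of_real (\<mu> * x $ i)" for i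
    by simp
  then have "(\<Sum>j\<in>UNIV. (if E i j then 1 else 0) * complex_of_real (x $ j)) = of_real \<mu> * of_real (x $ i)"
    for i by (simp add: if_distrib[of complex_of_real] cong: if_cong)
  then show "map_matrix (\<lambda>a. - \<i> * complex_of_real t * a) (adj_matrix E) *v (\<chi> i. complex_of_real (x $ i)) =
      (- \<i> * complex_of_real (t * \<mu>)) *s (\<chi> i. complex_of_real (x $ i))"
    by (simp add: vec_eq_iff matrix_vector_mult_def adj_matrix_def mult.assoc
        sum_distrib_left[symmetric] sum_negf)
qed

text \<open>
  Row \<open>u\<close> of the unitary matrix has norm \<open>1\<close>, so the diagonal entry of modulus \<open>1\<close> is its only
  nonzero entry.
\<close>

lemma periodic_phase:
  assumes "simple_graph E" and per: "cmod (transition_matrix E t $ u $ u) = 1"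
    and eig: "adj_matrix E *v (x :: real ^ 'a) = \<mu> *\<^sub>R x" and "x $ u \<noteq> 0"
  shows "transition_matrix E t $ u $ u = exp (- \<i> * complex_of_real (t * \<mu>))"
proof -
  let ?U = "transition_matrix E t"
  have "(\<Sum>j\<in>UNIV. (cmod (?U $ u $ j))\<^sup>2) = (cmod (?U $ u $ u))\<^sup>2 + (\<Sum>j\<in>UNIV - {u}. (cmod (?U $ u $ j))\<^sup>2)"
    by (rule sum.remove) auto
  then have "(\<Sum>j\<in>UNIV - {u}. (cmod (?U $ u $ j))\<^sup>2) = 0"
    using transition_matrix_row_norm[OF assms(1)] per by simp
  then have off: "?U $ u $ j = 0" if "j \<noteq> u" for j
    using that by (simp add: sum_nonneg_eq_0_iff)
  have "(?U *v (\<chi> i. complex_of_real (x $ i))) $ u = (\<Sum>j\<in>UNIV. if j = u then ?U $ u $ u * of_real (x $ u) else 0)"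
    unfolding matrix_vector_mult_def vec_lambda_beta by (rule sum.cong) (auto simp: off)
  then show ?thesis
    using transition_matrix_eigenvector[OF eig, of t] \<open>x $ u \<noteq> 0\<close> by (simp add: vec_eq_iff)
qed

text \<open>Both phases equal the same diagonal entry, and the complex exponential has period
  \<open>2 * pi * \<i>\<close>.\<close>

lemma periodic_eigenvalue_difference:
  assumes "simple_graph E" and "cmod (transition_matrix E t $ u $ u) = 1"
    and "adj_matrix E *v (x :: real ^ 'a) = \<mu> *\<^sub>R x" and "x $ u \<noteq> 0"
    and "adj_matrix E *v (y :: real ^ 'a) = \<nu> *\<^sub>R y" and "y $ u \<noteq> 0"
  shows "\<exists>n::int. t * (\<mu> - \<nu>) = of_int n * (2 * pi)"
proof -
  have "exp (- \<i> * complex_of_real (t * \<mu>)) = exp (- \<i> * complex_of_real (t * \<nu>))"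
    using periodic_phase[OF assms(1-4)] periodic_phase[OF assms(1,2,5,6)] by simp
  then obtain n :: int where
    "- \<i> * complex_of_real (t * \<mu>) = - \<i> * complex_of_real (t * \<nu>) + (of_int (2 * n) * pi) * \<i>"
    unfolding exp_eq by blast
  then have "t * (\<mu> - \<nu>) = of_int (- n) * (2 * pi)"
    by (auto simp: complex_eq_iff algebra_simps)
  then show ?thesis by blast
qed

section \<open>Eigenvectors nonzero at a given vertex, and their conjugates\<close>

text \<open>The projection \<open>y\<close> of the unit vector at \<open>v\<close> serves itself:
  its entry at \<open>v\<close> is \<open>inner y y\<close>, which is positive.\<close>

lemma eigenvalue_support_eigenvector:
  assumes "\<theta> \<in> eigenvalue_support E v"
  obtains x :: "real ^ 'a" where "adj_matrix E *v x = \<theta> *\<^sub>R x" and "x $ v \<noteq> 0"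
proof -
  let ?S = "eigenspace E \<theta>" and ?e = "axis v 1 :: real ^ 'a"
  have sub: "subspace ?S"
    by (auto simp: eigenspace_def intro!: subspaceI
        simp: matrix_vector_right_distrib scaleR_right_distrib matrix_vector_mult_scaleR)
  obtain y z where yz: "y \<in> span ?S" "\<And>w. w \<in> span ?S \<Longrightarrow> orthogonal z w" "?e = y + z"
    using orthogonal_subspace_decomp_exists[of ?S ?e] by blast
  have span: "span ?S = ?S" using sub by (simp add: span_eq_iff)
  have y: "y \<in> ?S" and z: "\<And>w. w \<in> ?S \<Longrightarrow> orthogonal (?e - y) w"
    using yz by (auto simp: span)
  \<comment> \<open>The difference of two candidates for the projection lies in the eigenspace and
    is orthogonal to itself.\<close>
  have "orth_proj ?S ?e = y"
    unfolding orth_proj_def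
  proof (rule the_equality)
    fix y' assume y': "y' \<in> ?S \<and> (\<forall>z\<in>?S. orthogonal (?e - y') z)"
    have "y - y' \<in> ?S" using sub y y' by (simp add: subspace_diff)
    then have "inner (?e - y') (y - y') = 0" "inner (?e - y) (y - y') = 0"
      using y' z by (auto simp: orthogonal_def)
    then have "inner (y - y') (y - y') = 0"
      by (simp add: inner_diff_left)
    then show "y' = y" by simp
  qed (use y z in auto)
  then have "y \<noteq> 0"
    using assms by (simp add: eigenvalue_support_def spectral_proj_def)
  moreover have "inner ?e y = inner y y"
    using z[OF y] by (simp add: orthogonal_def inner_diff_left)
  ultimately have "y $ v \<noteq> 0"
    by (simp add: inner_axis')
  then show ?thesis
    using y that by (auto simp: eigenspace_def)
qed

lemma sqrt_squarefree_irrational: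
  assumes "squarefree (D :: int)" and "D > 1"
  shows "sqrt (of_int D) \<notin> \<rat>"
proof
  assume "sqrt (of_int D) \<in> \<rat>"
  then obtain a b :: int where ab: "b > 0" "coprime a b" "sqrt (of_int D) = of_int a / of_int b"
    by (elim Rats_cases')
  then have "of_int D = (of_int a / of_int b :: real)\<^sup>2"
    using \<open>D > 1\<close> by (metis less_imp_le of_int_0_le_iff order_trans real_sqrt_pow2 zero_le_one)
  then have "of_int (D * b\<^sup>2) = (of_int (a\<^sup>2) :: real)"
    using ab(1) by (simp add: field_simps)
  then have eq: "D * b\<^sup>2 = a\<^sup>2"
    by (simp only: of_int_eq_iff)
  then have "b dvd a\<^sup>2"
    by (metis dvd_mult dvd_triv_left power2_eq_square)
  moreover have "coprime b (a\<^sup>2)"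
    using ab(2) by (simp add: coprime_commute)
  ultimately have "b = 1"
    using ab(1) by (metis coprime_common_divisor dvd_refl zdvd1_eq abs_of_pos)
  then have "a\<^sup>2 dvd D" using eq by simp
  then have "is_unit a"
    using assms(1) by (simp add: squarefree_def)
  then have "a\<^sup>2 = 1" by (auto simp: power2_eq_1_iff)
  then show False using eq \<open>b = 1\<close> \<open>D > 1\<close> by simp
qed

text \<open>The reals are a vector space over \<open>rat\<close> in which \<open>1\<close> is
  linearly independent, so the map sending \<open>1\<close> to \<open>1\<close> extends to a linear
  \<open>g\<close> into \<open>rat\<close>. Composing with \<open>of_rat\<close> keeps the values
  among the reals.\<close>

lemma rational_functional_exists:
  obtains \<psi> :: "real \<Rightarrow> real" where
    "\<And>a b. \<psi> (a + b) = \<psi> a + \<psi> b" and "\<And>q a. q \<in> \<rat> \<Longrightarrow> \<psi> (q * a) = q * \<psi> a"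
    and "range \<psi> \<subseteq> \<rat>" and "\<psi> 1 = 1"
proof -
  interpret vector_space_pair "\<lambda>q (a::real). of_rat q * a" "\<lambda>q (a::rat). q * a"
    by unfold_locales (simp_all add: algebra_simps of_rat_add of_rat_mult)
  have "vs1.independent {1}"
    by simp
  then obtain g where g: "Vector_Spaces.linear (\<lambda>q (a::real). of_rat q * a) (*) g" "g 1 = 1"
    using linear_independent_extend[of "{1}" "\<lambda>_. 1"] by auto
  interpret g: Vector_Spaces.linear "\<lambda>q (a::real). of_rat q * a" "(*)" g
    by (rule g(1))
  show thesis
  proof (rule that[of "\<lambda>a. of_rat (g a)"])
    show "of_rat (g (q * a)) = q * (of_rat (g a) :: real)" if "q \<in> \<rat>" for q a
      using that g.scale by (auto elim!: Rats_cases simp: of_rat_mult)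
  qed (auto simp: g.add of_rat_add g(2))
qed

text \<open>
  A \<open>\<rat>\<close>-linear functional \<open>\<psi>\<close> with \<open>\<psi> (x $ v) = 1\<close> turns \<open>x\<close> and \<open>\<theta> x\<close> into rational vectors
  \<open>p\<close> and \<open>q\<close> with \<open>A p = q\<close> and \<open>A q = \<theta>\<^sup>2 p\<close>; then \<open>q - \<theta> p\<close> is an eigenvector for \<open>-\<theta>\<close>, and its
  entry at \<open>v\<close> does not vanish because \<open>\<theta>\<close> is irrational.
\<close>

lemma conjugate_eigenvector:
  fixes E :: "'a::finite \<Rightarrow> 'a \<Rightarrow> bool" and x :: "real ^ 'a"
  assumes eig: "adj_matrix E *v x = \<theta> *\<^sub>R x" and "x $ v \<noteq> 0"
    and "\<theta> \<notin> \<rat>" and "\<theta>\<^sup>2 \<in> \<rat>"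
  obtains y :: "real ^ 'a" where "adj_matrix E *v y = (- \<theta>) *\<^sub>R y" and "y $ v \<noteq> 0"
proof -
  obtain \<psi> :: "real \<Rightarrow> real" where add: "\<And>a b. \<psi> (a + b) = \<psi> a + \<psi> b"
    and scale: "\<And>q a. q \<in> \<rat> \<Longrightarrow> \<psi> (q * a) = q * \<psi> a" and rat: "range \<psi> \<subseteq> \<rat>" and one: "\<psi> 1 = 1"
    using rational_functional_exists by blast
  have zero: "\<psi> 0 = 0" using scale[of 0 0] by simp
  have sum: "\<psi> (\<Sum>j\<in>S. f j) = (\<Sum>j\<in>S. \<psi> (f j))" for S and f :: "'a \<Rightarrow> real"
    by (induction S rule: infinite_finite_induct) (simp_all add: add zero)
  \<comment> \<open>Scaling makes the entry at \<open>v\<close> equal to \<open>1\<close>, where the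
    value of \<open>\<psi>\<close> is known.\<close>
  define z where "z = (1 / x $ v) *\<^sub>R x"
  have z: "(\<Sum>j\<in>UNIV. if E i j then z $ j else 0) = \<theta> * z $ i" for i
  proof -
    have "adj_matrix E *v z = \<theta> *\<^sub>R z"
      by (simp add: z_def matrix_vector_mult_scaleR eig)
    then have "(adj_matrix E *v z) $ i = \<theta> * z $ i" by simp
    then show ?thesis
      by (simp add: matrix_vector_mult_def adj_matrix_def if_distrib[of "\<lambda>a. a * _"] cong: if_cong)
  qed
  define p where "p i = \<psi> (z $ i)" for i
  define q where "q i = \<psi> (\<theta> * z $ i)" for i
  have p: "(\<Sum>j\<in>UNIV. if E i j then p j else 0) = q i" for i
    using arg_cong[OF z[of i], of \<psi>]
    by (simp add: p_def q_def sum if_distrib[of \<psi>] zero cong: if_cong)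
  \<comment> \<open>Only rational factors pass through \<open>\<psi>\<close>: a single
    \<open>\<theta>\<close> stays inside, in \<open>q\<close>, whereas
    \<open>\<theta>\<^sup>2\<close> comes out.\<close>
  have q: "(\<Sum>j\<in>UNIV. if E i j then q j else 0) = \<theta>\<^sup>2 * p i" for i
  proof -
    have "(\<Sum>j\<in>UNIV. if E i j then \<theta> * z $ j else 0) = \<theta>\<^sup>2 * z $ i"
      using arg_cong[OF z[of i], of "(*) \<theta>"]
      by (simp add: sum_distrib_left if_distrib[of "(*) \<theta>"] power2_eq_square mult.assoc cong: if_cong)
    from arg_cong[OF this, of \<psi>] show ?thesis
      by (simp add: p_def q_def sum if_distrib[of \<psi>] zero scale \<open>\<theta>\<^sup>2 \<in> \<rat>\<close> cong: if_cong)
  qed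
  define y :: "real ^ 'a" where "y = (\<chi> i. q i - \<theta> * p i)"
  have "(\<Sum>j\<in>UNIV. if E i j then q j - \<theta> * p j else 0) = - \<theta> * (q i - \<theta> * p i)" for i
  proof -
    have "(\<Sum>j\<in>UNIV. if E i j then q j - \<theta> * p j else 0) =
        (\<Sum>j\<in>UNIV. (if E i j then q j else 0) - \<theta> * (if E i j then p j else 0))"
      by (rule sum.cong) auto
    also have "\<dots> = \<theta>\<^sup>2 * p i - \<theta> * q i"
      by (simp only: sum_subtractf sum_distrib_left[symmetric] p q)
    finally show ?thesis by (simp add: algebra_simps power2_eq_square)
  qed
  then have "adj_matrix E *v y = (- \<theta>) *\<^sub>R y"
    by (simp add: vec_eq_iff y_def matrix_vector_mult_def adj_matrix_def if_distrib[of "\<lambda>a. a * _"] cong: if_cong)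
  moreover have "y $ v \<noteq> 0"
  proof
    assume "y $ v = 0"
    moreover have "p v = 1" using one \<open>x $ v \<noteq> 0\<close> by (simp add: p_def z_def)
    ultimately have "\<theta> = q v" by (simp add: y_def)
    then show False using rat \<open>\<theta> \<notin> \<rat>\<close> by (auto simp: q_def)
  qed
  ultimately show ?thesis by (rule that)
qed

section \<open>Lifting eigenvectors to the neighborhood corona\<close>

lemma sum_prod_option:
  fixes f :: "'a::finite \<times> 'b::finite option \<Rightarrow> real"
  shows "(\<Sum>p\<in>UNIV. f p) = (\<Sum>x\<in>UNIV. f (x, None) + (\<Sum>y\<in>UNIV. f (x, Some y)))"
proof -
  have "(\<Sum>p\<in>UNIV. f p) = (\<Sum>x\<in>UNIV. \<Sum>y\<in>UNIV. f (x, y))"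
    unfolding UNIV_Times_UNIV[symmetric] by (simp only: sum.cartesian_product split_def prod.collapse)
  moreover have "(\<Sum>y\<in>UNIV. f (x, y)) = f (x, None) + (\<Sum>y\<in>UNIV. f (x, Some y))" for x
    by (simp add: UNIV_option_conv sum.reindex)
  ultimately show ?thesis by simp
qed

text \<open>The ansatz is \<open>x\<close> scaled by one constant on the base graph and by another
  on all copies. With \<open>\<mu> - real k\<close> and \<open>\<theta>\<close> the rows at copy
  vertices hold by regularity, and the rows at base vertices reduce to \<open>root\<close>. Both
  constants are nonzero, so every \<open>w\<close> is covered.\<close>

lemma nbhd_corona_eigenvector:
  fixes E\<^sub>1 :: "'a::finite \<Rightarrow> 'a \<Rightarrow> bool" and E\<^sub>2 :: "'b::finite \<Rightarrow> 'b \<Rightarrow> bool" and x :: "real ^ 'a"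
  assumes "simple_graph E\<^sub>1" and reg: "regular_graph k E\<^sub>2"
    and eig: "adj_matrix E\<^sub>1 *v x = \<theta> *\<^sub>R x" and "x $ v \<noteq> 0" and "\<theta> \<noteq> 0"
    and root: "(\<mu> - \<theta>) * (\<mu> - real k) = real CARD('b) * \<theta>\<^sup>2"
  obtains z :: "real ^ ('a \<times> 'b option)"
  where "adj_matrix (nbhd_corona E\<^sub>1 E\<^sub>2) *v z = \<mu> *\<^sub>R z" and "z $ (v, w) \<noteq> 0"
proof -
  define z :: "real ^ ('a \<times> 'b option)" where
    "z = (\<chi> p. case snd p of None \<Rightarrow> (\<mu> - real k) * x $ fst p | Some _ \<Rightarrow> \<theta> * x $ fst p)"
  have sym: "E\<^sub>1 i j = E\<^sub>1 j i" for i j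
    using assms(1) by (auto simp: simple_graph_def dest: sympD)
  have x: "(\<Sum>j\<in>UNIV. if E\<^sub>1 i j then c * x $ j else 0) = c * (\<theta> * x $ i)" for i c
  proof -
    have "(adj_matrix E\<^sub>1 *v x) $ i = \<theta> * x $ i" using eig by simp
    then have "(\<Sum>j\<in>UNIV. if E\<^sub>1 i j then x $ j else 0) = \<theta> * x $ i"
      by (simp add: matrix_vector_mult_def adj_matrix_def if_distrib[of "\<lambda>a. a * _"] cong: if_cong)
    from arg_cong[OF this, of "(*) c"] show ?thesis
      by (simp add: sum_distrib_left if_distrib[of "(*) c"] cong: if_cong)
  qed
  have row: "(adj_matrix (nbhd_corona E\<^sub>1 E\<^sub>2) *v z) $ p =
      (\<Sum>q\<in>UNIV. if nbhd_corona E\<^sub>1 E\<^sub>2 p q then z $ q else 0)" for p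
    by (simp add: matrix_vector_mult_def adj_matrix_def if_distrib[of "\<lambda>a. a * _"] cong: if_cong)
  have "(adj_matrix (nbhd_corona E\<^sub>1 E\<^sub>2) *v z) $ (i, s) = \<mu> * z $ (i, s)" for i s
  proof (cases s)
    case None
    have "(adj_matrix (nbhd_corona E\<^sub>1 E\<^sub>2) *v z) $ (i, s) =
        (\<Sum>j\<in>UNIV. if E\<^sub>1 i j then (\<mu> - real k + real CARD('b) * \<theta>) * x $ j else 0)"
      unfolding row sum_prod_option
      by (rule sum.cong) (auto simp: None z_def sym[of _ i] algebra_simps)
    also have "\<dots> = (\<mu> - real k) * \<theta> * x $ i + real CARD('b) * \<theta>\<^sup>2 * x $ i"
      unfolding x by (simp add: algebra_simps power2_eq_square)
    also have "\<dots> = \<mu> * z $ (i, s)"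
      unfolding root[symmetric] by (simp add: None z_def algebra_simps)
    finally show ?thesis .
  next
    case (Some y)
    have "(\<Sum>y'\<in>UNIV. if E\<^sub>2 y y' then \<theta> * x $ i else 0) = real k * (\<theta> * x $ i)"
      using reg by (simp add: sum.If_cases regular_graph_def)
    then have "(\<Sum>y'\<in>UNIV. if i = j \<and> E\<^sub>2 y y' then \<theta> * x $ j else 0) =
        (if i = j then real k * (\<theta> * x $ i) else 0)" for j
      by auto
    then have "(adj_matrix (nbhd_corona E\<^sub>1 E\<^sub>2) *v z) $ (i, s) =
        (\<Sum>j\<in>UNIV. if E\<^sub>1 i j then (\<mu> - real k) * x $ j else 0) + real k * (\<theta> * x $ i)"
      unfolding row sum_prod_option by (simp add: Some z_def sum.distrib cong: if_cong)
    then show ?thesis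
      unfolding x by (simp add: Some z_def algebra_simps)
  qed
  then have "adj_matrix (nbhd_corona E\<^sub>1 E\<^sub>2) *v z = \<mu> *\<^sub>R z"
    by (simp add: vec_eq_iff)
  \<comment> \<open>Otherwise the left side of \<open>root\<close> vanishes while the right side is
    positive.\<close>
  moreover have "\<mu> \<noteq> real k"
    using root \<open>\<theta> \<noteq> 0\<close> by auto
  then have "z $ (v, w) \<noteq> 0"
    using \<open>x $ v \<noteq> 0\<close> \<open>\<theta> \<noteq> 0\<close> by (cases w) (auto simp: z_def)
  ultimately show ?thesis by (rule that)
qed

section \<open>The edgeless case and the final contradiction\<close>

text \<open>Without edges, reachability is equality.\<close>

lemma connected_0_regular_card:
  fixes E :: "'b::finite \<Rightarrow> 'b \<Rightarrow> bool"
  assumes "connected_graph E" and "regular_graph 0 E"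
  shows "CARD('b) = 1"
proof -
  have no: "\<not> E x y" for x y :: 'b
    using assms(2) by (auto simp: regular_graph_def)
  have "x = y" for x y :: 'b
  proof -
    have "E\<^sup>*\<^sup>* x y" using assms(1) by (simp add: connected_graph_def)
    then show ?thesis by induction (simp_all add: no)
  qed
  then have "UNIV = {undefined :: 'b}" by auto
  then show ?thesis by (metis card_1_singleton_iff One_nat_def)
qed

theorem theorem4p5:
  fixes E\<^sub>1 :: "'a::finite \<Rightarrow> 'a \<Rightarrow> bool"
    and E\<^sub>2 :: "'b::finite \<Rightarrow> 'b \<Rightarrow> bool"
    and k m\<^sub>2 :: nat
    and v :: 'a
    and w :: "'b option"
    and \<theta> :: real
    and \<Delta>' :: int
  assumes "simple_graph E\<^sub>1" and "connected_graph E\<^sub>1"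
    and "simple_graph E\<^sub>2" and "connected_graph E\<^sub>2" and "regular_graph k E\<^sub>2"
    and "CARD('b) = m\<^sub>2"
    and "squarefree \<Delta>'" and "\<Delta>' > 1"
    and "\<theta> \<in> eigenvalue_support E\<^sub>1 v"
    and "\<theta> \<in> int_multiples_sqrt \<Delta>'"
    and "\<theta> \<noteq> 0"
  shows "\<not> periodic_vertex (nbhd_corona E\<^sub>1 E\<^sub>2) (v, w)"
proof
  let ?G = "nbhd_corona E\<^sub>1 E\<^sub>2"
  assume "periodic_vertex ?G (v, w)"
  then obtain t where t: "t > 0" and per: "cmod (transition_matrix ?G t $ (v, w) $ (v, w)) = 1"
    by (auto simp: periodic_vertex_def)
  have simple: "simple_graph ?G"
    using assms(1,3) by (rule simple_graph_nbhd_corona)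
  obtain b :: int where b: "\<theta> = of_int b * sqrt (of_int \<Delta>')"
    using assms(10) by (auto simp: int_multiples_sqrt_def)
  have irr: "\<theta> \<notin> \<rat>"
  proof
    assume "\<theta> \<in> \<rat>"
    then have "\<theta> / of_int b \<in> \<rat>" by simp
    then show False
      using b \<open>\<theta> \<noteq> 0\<close> sqrt_squarefree_irrational[OF assms(7,8)] by simp
  qed
  have rat: "\<theta>\<^sup>2 \<in> \<rat>"
    using assms(8) by (simp add: b power_mult_distrib)
  obtain x :: "real ^ 'a" where x: "adj_matrix E\<^sub>1 *v x = \<theta> *\<^sub>R x" "x $ v \<noteq> 0"
    using eigenvalue_support_eigenvector[OF assms(9)] .
  obtain x' :: "real ^ 'a" where x': "adj_matrix E\<^sub>1 *v x' = (- \<theta>) *\<^sub>R x'" "x' $ v \<noteq> 0"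
    using conjugate_eigenvector[OF x irr rat] .
  \<comment> \<open>\<open>(S \<eta>)\<^sup>2\<close> is the discriminant of the quadratic for
    \<open>\<mu>\<close>; below, \<open>s\<close> is a sign, encoded as
    \<open>s\<^sup>2 = 1\<close>, that selects the root.\<close>
  define S where "S \<equiv> \<lambda>\<eta>. sqrt ((real k - \<eta>)\<^sup>2 + 4 * real m\<^sub>2 * \<eta>\<^sup>2)"
  define \<mu> where "\<mu> \<equiv> \<lambda>\<eta> s. (real k + \<eta> + s * S \<eta>) / 2"
  have S2: "(S \<eta>)\<^sup>2 = (real k - \<eta>)\<^sup>2 + 4 * real m\<^sub>2 * \<eta>\<^sup>2" for \<eta>
    by (simp add: S_def)
  have root: "(\<mu> \<eta> s - \<eta>) * (\<mu> \<eta> s - real k) = real CARD('b) * \<eta>\<^sup>2" if "s\<^sup>2 = 1" for \<eta> s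
  proof -
    have "(\<mu> \<eta> s - \<eta>) * (\<mu> \<eta> s - real k) = (s\<^sup>2 * (S \<eta>)\<^sup>2 - (real k - \<eta>)\<^sup>2) / 4"
      by (simp add: \<mu>_def field_simps power2_eq_square)
    then show ?thesis by (simp add: that S2 assms(6))
  qed
  have "\<exists>z :: real ^ ('a \<times> 'b option). adj_matrix ?G *v z = \<mu> \<eta> s *\<^sub>R z \<and> z $ (v, w) \<noteq> 0"
    if "\<eta> \<in> {\<theta>, - \<theta>}" "s\<^sup>2 = 1" for \<eta> s
  proof -
    obtain y :: "real ^ 'a" where y: "adj_matrix E\<^sub>1 *v y = \<eta> *\<^sub>R y" "y $ v \<noteq> 0"
      using \<open>\<eta> \<in> {\<theta>, - \<theta>}\<close> x x' by blast
    have "\<eta> \<noteq> 0" using \<open>\<eta> \<in> {\<theta>, - \<theta>}\<close> \<open>\<theta> \<noteq> 0\<close> by auto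
    then show ?thesis
      using nbhd_corona_eigenvector[OF assms(1,5) y _ root[OF that(2)]] by metis
  qed
  then have diff: "\<exists>n::int. t * (\<mu> \<eta> s - \<mu> \<eta>' s') = of_int n * (2 * pi)"
    if "\<eta> \<in> {\<theta>, - \<theta>}" "s\<^sup>2 = 1" "\<eta>' \<in> {\<theta>, - \<theta>}" "s'\<^sup>2 = 1" for \<eta> s \<eta>' s'
    using that periodic_eigenvalue_difference[OF simple per] by metis
  \<comment> \<open>The factor \<open>t\<close> and the period cancel. For \<open>c = 0\<close> the
    quotient is \<open>0\<close> by convention, hence still rational.\<close>
  have quot: "a / c \<in> \<rat>"
    if ac: "\<exists>n::int. t * a = of_int n * (2 * pi)" "\<exists>n::int. t * c = of_int n * (2 * pi)" for a c
  proof -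
    obtain n m :: int where "t * a = of_int n * (2 * pi)" "t * c = of_int m * (2 * pi)"
      using ac by blast
    moreover have "a / c = (t * a) / (t * c)" using t by simp
    ultimately have "a / c = of_int n / of_int m" by simp
    then show ?thesis by simp
  qed
  \<comment> \<open>\<open>S \<eta>\<close> is the difference of the two roots over the same
    \<open>\<eta>\<close>.\<close>
  have step: "\<exists>n::int. t * S \<eta> = of_int n * (2 * pi)" if "\<eta> \<in> {\<theta>, - \<theta>}" for \<eta>
    using diff[OF that _ that, of 1 "-1"] by (simp add: \<mu>_def diff_divide_distrib[symmetric])
  show False
  proof (cases "k = 0")
    case True
    then have "m\<^sub>2 = 1"
      using connected_0_regular_card assms(4,5,6) by metis
    then have S: "S \<eta> = sqrt 5 * \<bar>\<eta>\<bar>" for \<eta>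
      using True by (simp add: S_def real_sqrt_mult)
    \<comment> \<open>Here \<open>S\<close> is even, so it cancels between the upper roots over
      \<open>\<theta>\<close> and \<open>- \<theta>\<close>, leaving
      \<open>\<theta>\<close>.\<close>
    have "\<exists>n::int. t * \<theta> = of_int n * (2 * pi)"
      using diff[of \<theta> 1 "- \<theta>" 1] by (simp add: \<mu>_def S diff_divide_distrib[symmetric])
    with step[of \<theta>] have "sqrt 5 * \<bar>\<theta>\<bar> / \<theta> \<in> \<rat>"
      using quot[of "S \<theta>" \<theta>] by (simp add: S)
    \<comment> \<open>The absolute value removes the unknown sign of
      \<open>\<theta>\<close>.\<close>
    then have "\<bar>sqrt 5 * \<bar>\<theta>\<bar> / \<theta>\<bar> \<in> \<rat>"
      by (simp only: Rats_abs_iff)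
    then have "sqrt 5 \<in> \<rat>"
      using \<open>\<theta> \<noteq> 0\<close> by (simp add: abs_mult)
    moreover have "squarefree (5 :: int)"
      by (intro squarefree_prime_elem) simp
    ultimately show False
      using sqrt_squarefree_irrational[of 5] by simp
  next
    case False
    have "m\<^sub>2 > 0" using assms(6) by (metis zero_less_card_finite)
    then have pos: "(S \<eta>)\<^sup>2 > 0" if "\<eta> \<noteq> 0" for \<eta>
      unfolding S2 using that by (intro add_nonneg_pos) auto
    define r where "r = (S \<theta> / S (- \<theta>))\<^sup>2"
    have r: "r \<in> \<rat>"
      unfolding r_def using quot[OF step step] by simp
    have "r > 0" unfolding r_def power_divide using pos \<open>\<theta> \<noteq> 0\<close> by simp
    have "(S \<theta>)\<^sup>2 = r * (S (- \<theta>))\<^sup>2"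
      using pos[of "- \<theta>"] \<open>\<theta> \<noteq> 0\<close> by (simp add: r_def power_divide)
    \<comment> \<open>Collecting the terms odd in \<open>\<theta>\<close> on the left isolates
      \<open>\<theta>\<close>, as all else involves only \<open>\<theta>\<^sup>2\<close> and
      rationals; \<open>k \<noteq> 0\<close> and \<open>r > 0\<close> permit the division.\<close>
    then have "\<theta> * (2 * real k * (1 + r)) = (1 - r) * ((real k)\<^sup>2 + (1 + 4 * real m\<^sub>2) * \<theta>\<^sup>2)"
      unfolding S2 by algebra
    moreover have "2 * real k * (1 + r) \<noteq> 0" using False \<open>r > 0\<close> by simp
    ultimately have "\<theta> = (1 - r) * ((real k)\<^sup>2 + (1 + 4 * real m\<^sub>2) * \<theta>\<^sup>2) / (2 * real k * (1 + r))"
      by (simp only: nonzero_eq_divide_eq not_False_eq_True)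
    moreover have "\<dots> \<in> \<rat>"
      using r rat by simp
    ultimately show False using irr by simp
  qed
qed

end
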